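(* Let $d \in \{2,3\}$ and assume that $\psi \colon \mathbb{R}^d \to \mathbb{R}_\infty$ is convex, lower semicontinuous and satisfies $$\psi(e(\nu)) = \psi(e(\operatorname{diag}(\epsilon)\nu)) \quad\text{for all } \nu\in\mathbb{R}^d \text{ and all } \epsilon\in\{-1,1\}^d \text{ with } \prod_{i=1}^d\epsilon_i=1 .$$ Then the function $\Phi\colon\mathbb{R}^d\to\mathbb{R}_\infty$ given by $\Phi(\nu)=\psi(e(\nu))$ is lower semicontinuous signed singular value polyconvex.
   Context: $\mathbb{R}_\infty := \mathbb{R}\cup\{\infty\}$. $\operatorname{diag}(\nu)$ is the diagonal matrix with entries $\nu_1,\dots,\nu_d$. The map $e\colon\mathbb{R}^d\to\mathbb{R}^d$ of elementary symmetric polynomials is $e(x)=(x_1+x_2,\;x_1x_2)$ for $d=2$ and $e(x)=(x_1+x_2+x_3,\;x_2x_3+x_1x_3+x_1x_2,\;x_1x_2x_3)$ for $d=3$. $\Pi(d) := \{S\operatorname{diag}(\epsilon) \mid S \text{ a } d\times d \text{ permutation matrix},\ \epsilon\in\{-1,1\}^d,\ \prod_i\epsilon_i=1\}$; $\Phi\colon\mathbb{R}^d\to\mathbb{R}_\infty$ is $\Pi(d)$-invariant if $\Phi(S\nu)=\Phi(\nu)$ for all $\nu\in\mathbb{R}^d$, $S\in\Pi(d)$. Every $F\in\mathbb{R}^{d\times d}$ can be written $F=R_1\operatorname{diag}(\nu)R_2$ with $R_1,R_2\in\mathrm{SO}(d)$, $\nu\in\mathbb{R}^d$; any such $\nu$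 is called (a choice of) signed singular values of $F$, and it is unique up to the action of $\Pi(d)$. Hence a $\Pi(d)$-invariant $\Phi$ determines a function $W\colon\mathbb{R}^{d\times d}\to\mathbb{R}_\infty$ by $W(F):=\Phi(\nu_F)$, with $\nu_F$ any signed singular values of $F$. A $\Pi(d)$-invariant $\Phi$ is called lower semicontinuous signed singular value polyconvex if this $W$ is lower semicontinuous polyconvex, i.e. there is a lower semicontinuous convex $G\colon\mathbb{R}^{K_d}\to\mathbb{R}_\infty$ with $W(F)=G(\mathcal{M}(F))$ for all $F$, where $\mathcal{M}(F)$ is the vector of all minors of $F$: $\mathcal{M}(F)=(F,\det F)\in\mathbb{R}^5$ ($K_2=5$) for $d=2$, and $\mathcal{M}(F)=(F,\operatorname{adj}(F)^\top,\det F)\in\mathbb{R}^{19}$ ($K_3=19$) for $d=3$. *)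

theory Defs
  imports "HOL-Analysis.Analysis"
begin

(* The codomain R \<union> {\<infinity>}, as a set of extended reals. *)
definition Rinf :: "ereal set" where
  "Rinf = {r. r \<noteq> -\<infinity>}"

(* Intended for functions with values in Rinf only: ereal arithmetic sets \<infinity> + (-\<infinity>) = \<infinity>. *)
definition convex_ext :: "('a::real_vector \<Rightarrow> ereal) \<Rightarrow> bool" where
  "convex_ext f \<longleftrightarrow>
     (\<forall>x y t. 0 < t \<and> t < 1 \<longrightarrow>
        f ((1 - t) *\<^sub>R x + t *\<^sub>R y) \<le> ereal (1 - t) * f x + ereal t * f y)"

definition lower_semicontinuous :: "('a::topological_space \<Rightarrow> ereal) \<Rightarrow> bool" where
  "lower_semicontinuous f \<longleftrightarrow> (\<forall>x. f x \<le> Liminf (at x) f)"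

definition diag :: "real^'n \<Rightarrow> real^'n^'n" where
  "diag v = (\<chi> i j. if i = j then v $ i else 0)"

definition even_signs :: "(real^'n) set" where
  "even_signs = {\<epsilon>. (\<forall>i. \<epsilon> $ i \<in> {-1, 1}) \<and> (\<Prod>i\<in>UNIV. \<epsilon> $ i) = 1}"

definition permutation_matrix :: "real^'n^'n \<Rightarrow> bool" where
  "permutation_matrix S \<longleftrightarrow>
     (\<exists>p. p permutes UNIV \<and> S = (\<chi> i j. if i = p j then 1 else 0))"

definition signed_perms :: "(real^'n^'n) set" where
  "signed_perms = {S ** diag \<epsilon> | S \<epsilon>. permutation_matrix S \<and> \<epsilon> \<in> even_signs}"

definition signed_perm_invariant :: "(real^'n \<Rightarrow> ereal) \<Rightarrow> bool" where
  "signed_perm_invariant \<Phi> \<longleftrightarrow> (\<forall>\<nu>. \<forall>S\<in>signed_perms. \<Phi> (S *v \<nu>) = \<Phi> \<nu>)"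

definition signed_singular_values :: "real^'n^'n \<Rightarrow> real^'n \<Rightarrow> bool" where
  "signed_singular_values F \<nu> \<longleftrightarrow>
     (\<exists>R1 R2. rotation_matrix R1 \<and> rotation_matrix R2 \<and> F = R1 ** diag \<nu> ** R2)"

(* Every F has signed singular values, unique up to signed_perms, so the choice made here is
   immaterial for invariant \<Phi>. *)
definition ssv_matrix_function :: "(real^'n \<Rightarrow> ereal) \<Rightarrow> real^'n^'n \<Rightarrow> ereal" where
  "ssv_matrix_function \<Phi> F = \<Phi> (SOME \<nu>. signed_singular_values F \<nu>)"

(* The (i,j) cofactor: replacing row i and column j by unit vectors gives
   (-1)^(i+j) times the minor with row i and column j deleted. *)
definition cofactor_matrix :: "real^'n^'n \<Rightarrow> real^'n^'n" where
  "cofactor_matrix F = (\<chi> i j. det (\<chi> k l.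
     if k = i \<and> l = j then 1 else if k = i \<or> l = j then 0 else F $ k $ l))"

definition adjugate :: "real^'n^'n \<Rightarrow> real^'n^'n" where
  "adjugate F = transpose (cofactor_matrix F)"

lemma adjugate_mult_3:
  fixes F :: "real^3^3"
  shows "F ** adjugate F = mat (det F)"
  by (simp add: vec_eq_iff forall_3 matrix_matrix_mult_def adjugate_def cofactor_matrix_def
      transpose_def mat_def det_3 sum_3 algebra_simps)

(* The product types play the roles of R^5 and R^19. *)
definition minors2 :: "real^2^2 \<Rightarrow> (real^2^2) \<times> real" where
  "minors2 F = (F, det F)"

definition minors3 :: "real^3^3 \<Rightarrow> (real^3^3) \<times> (real^3^3) \<times> real" where
  "minors3 F = (F, transpose (adjugate F), det F)"

(* The parameter M is the map sending a matrix to the vector of all its minors: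
   minors2 or minors3, according to the dimension. *)
definition lsc_polyconvex ::
    "(real^'n^'n \<Rightarrow> 'm::euclidean_space) \<Rightarrow> (real^'n^'n \<Rightarrow> ereal) \<Rightarrow> bool" where
  "lsc_polyconvex M W \<longleftrightarrow>
     (\<exists>G. range G \<subseteq> Rinf \<and> convex_ext G \<and> lower_semicontinuous G \<and> (\<forall>F. W F = G (M F)))"

definition lsc_ssv_polyconvex ::
    "(real^'n^'n \<Rightarrow> 'm::euclidean_space) \<Rightarrow> (real^'n \<Rightarrow> ereal) \<Rightarrow> bool" where
  "lsc_ssv_polyconvex M \<Phi> \<longleftrightarrow>
     range \<Phi> \<subseteq> Rinf \<and> signed_perm_invariant \<Phi> \<and> lsc_polyconvex M (ssv_matrix_function \<Phi>)"

definition esym2 :: "real^2 \<Rightarrow> real^2" where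
  "esym2 x = vector [x$1 + x$2, x$1 * x$2]"

definition esym3 :: "real^3 \<Rightarrow> real^3" where
  "esym3 x = vector [x$1 + x$2 + x$3, x$2 * x$3 + x$1 * x$3 + x$1 * x$2, x$1 * x$2 * x$3]"

end

(* The convex extension of W to the vector of minors is
   G(F, A, delta) = sup over rotations Q of psi(tr(Q F), tr(Q A), delta),
   without the argument A in dimension 2.
   For F = R1 diag(nu) R2 the rotation Q = R2^T R1^T attains psi(e(nu)). For an
   arbitrary Q, cyclic invariance of the trace and cof(R F) = R cof(F) turn the argument
   of psi into (sum r_ii nu_i, sum r_ii nu_j nu_k, det F) for a rotation R. The
   diagonal of a rotation is a convex combination of even sign vectors (in dimension 3 because
   every rotation has trace at least -1), so the argument is a convex combination of points
   e(diag(eps) nu), at all of which psi has the value psi(e(nu)). *)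

theory Submission
  imports Defs
begin

section \<open>Extended-valued convex and lower semicontinuous functions\<close>

lemma lower_semicontinuous_iff_nhds:
  "lower_semicontinuous f \<longleftrightarrow> (\<forall>x. \<forall>c<f x. eventually (\<lambda>y. c < f y) (nhds x))"
  unfolding lower_semicontinuous_def le_Liminf_iff by (auto simp: eventually_nhds_conv_at)

lemma lower_semicontinuous_compose:
  assumes "lower_semicontinuous f" "\<And>x. isCont L x"
  shows "lower_semicontinuous (\<lambda>x. f (L x))"
  unfolding lower_semicontinuous_iff_nhds
proof (intro allI impI)
  fix x c assume "c < f (L x)"
  then have "eventually (\<lambda>y. c < f y) (nhds (L x))"
    using assms(1) by (simp add: lower_semicontinuous_iff_nhds)
  moreover have "filterlim L (nhds (L x)) (nhds x)"
    using assms(2)[of x] by (simp add: isCont_def tendsto_at_iff_tendsto_nhds)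
  ultimately show "eventually (\<lambda>y. c < f (L y)) (nhds x)"
    by (rule eventually_compose_filterlim)
qed

lemma lower_semicontinuous_SUP:
  assumes "\<And>i. i \<in> I \<Longrightarrow> lower_semicontinuous (f i)"
  shows "lower_semicontinuous (\<lambda>x. SUP i\<in>I. f i x)"
  unfolding lower_semicontinuous_iff_nhds
proof (intro allI impI)
  fix x c assume "c < (SUP i\<in>I. f i x)"
  then obtain i where larger: "i \<in> I" "c < f i x"
    by (auto simp: less_SUP_iff)
  then have "eventually (\<lambda>y. c < f i y) (nhds x)"
    using assms by (simp add: lower_semicontinuous_iff_nhds)
  then show "eventually (\<lambda>y. c < (SUP i\<in>I. f i y)) (nhds x)"
    by eventually_elim (use larger in \<open>auto simp: less_SUP_iff\<close>)
qed

lemma convex_ext_compose_affine: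
  assumes "convex_ext f"
    and "\<And>x y t. L ((1 - t) *\<^sub>R x + t *\<^sub>R y) = (1 - t) *\<^sub>R L x + t *\<^sub>R L y"
  shows "convex_ext (\<lambda>x. f (L x))"
  using assms by (simp add: convex_ext_def)

lemma convex_ext_SUP:
  assumes "\<And>i. i \<in> I \<Longrightarrow> convex_ext (f i)"
  shows "convex_ext (\<lambda>x. SUP i\<in>I. f i x)"
  unfolding convex_ext_def
proof (intro allI impI SUP_least)
  fix x y i and t :: real
  assume "0 < t \<and> t < 1" and "i \<in> I"
  have "f i ((1 - t) *\<^sub>R x + t *\<^sub>R y) \<le> ereal (1 - t) * f i x + ereal t * f i y"
    using assms[OF \<open>i \<in> I\<close>] \<open>0 < t \<and> t < 1\<close> by (simp add: convex_ext_def)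
  also have "\<dots> \<le> ereal (1 - t) * (SUP i\<in>I. f i x) + ereal t * (SUP i\<in>I. f i y)"
    using \<open>0 < t \<and> t < 1\<close> \<open>i \<in> I\<close> by (intro add_mono ereal_mult_left_mono SUP_upper) auto
  finally show "f i ((1 - t) *\<^sub>R x + t *\<^sub>R y)
      \<le> ereal (1 - t) * (SUP i\<in>I. f i x) + ereal t * (SUP i\<in>I. f i y)" .
qed

lemma convex_sublevel_convex_ext:
  assumes "convex_ext f"
  shows "convex {x. f x \<le> c}"
  unfolding convex_alt
proof (intro ballI allI impI)
  fix x y and t :: real
  assume sublevel: "x \<in> {x. f x \<le> c}" "y \<in> {x. f x \<le> c}" and "0 \<le> t \<and> t \<le> 1"
  show "(1 - t) *\<^sub>R x + t *\<^sub>R y \<in> {x. f x \<le> c}"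
  proof (cases "t = 0 \<or> t = 1")
    case True
    then show ?thesis using sublevel by auto
  next
    case False
    then have interior: "0 < t" "t < 1" using \<open>0 \<le> t \<and> t \<le> 1\<close> by auto
    have "f ((1 - t) *\<^sub>R x + t *\<^sub>R y) \<le> ereal (1 - t) * f x + ereal t * f y"
      using assms interior by (simp add: convex_ext_def)
    also have "\<dots> \<le> ereal (1 - t) * c + ereal t * c"
      using interior sublevel by (intro add_mono ereal_mult_left_mono) auto
    also have "\<dots> = c"
      using interior by (cases c) (auto simp: algebra_simps)
    finally show ?thesis by simp
  qed
qed

lemma convex_ext_le_on_convex_hull:
  assumes "convex_ext f" "\<And>x. x \<in> S \<Longrightarrow> f x \<le> c" "y \<in> convex hull S"
  shows "f y \<le> c"
  using hull_minimal[of S "{x. f x \<le> c}" convex] convex_sublevel_convex_ext[OF assms(1)] assms(2,3)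
  by auto

lemma lsc_polyconvex_SUP_linear:
  fixes \<psi> :: "'b::real_normed_vector \<Rightarrow> ereal" and M :: "real^'n^'n \<Rightarrow> 'm::euclidean_space"
  assumes \<psi>: "range \<psi> \<subseteq> Rinf" "convex_ext \<psi>" "lower_semicontinuous \<psi>"
    and linear: "\<And>i. i \<in> I \<Longrightarrow> linear (L i)" and "I \<noteq> {}"
  shows "lsc_polyconvex M (\<lambda>F. SUP i\<in>I. \<psi> (L i (M F)))"
  unfolding lsc_polyconvex_def
proof (intro exI conjI allI)
  let ?G = "\<lambda>z. SUP i\<in>I. \<psi> (L i z)"
  obtain j where "j \<in> I" using \<open>I \<noteq> {}\<close> by auto
  show "range ?G \<subseteq> Rinf"
  proof safe
    fix z
    have "-\<infinity> < \<psi> (L j z)" using \<psi>(1) by (auto simp: Rinf_def)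
    also have "\<dots> \<le> ?G z" using \<open>j \<in> I\<close> by (rule SUP_upper)
    finally show "?G z \<in> Rinf" by (simp add: Rinf_def)
  qed
  show "convex_ext ?G"
    using linear by (intro convex_ext_SUP convex_ext_compose_affine[OF \<psi>(2)])
      (simp add: linear_add linear_scale)
  show "lower_semicontinuous ?G"
    using linear by (intro lower_semicontinuous_SUP lower_semicontinuous_compose[OF \<psi>(3)])
      (simp add: linear_conv_bounded_linear linear_continuous_at)
qed simp

section \<open>Diagonal matrices, rotations and signed permutations\<close>

definition diagonal :: "real^'n^'n \<Rightarrow> real^'n" where
  "diagonal A = (\<chi> i. A $ i $ i)"

lemma trace_mult_diag: "trace (A ** diag \<nu>) = (\<Sum>i\<in>UNIV. A $ i $ i * \<nu> $ i)"
  by (simp add: trace_def matrix_matrix_mult_def diag_def if_distrib[of "\<lambda>x. _ * x"] cong: if_cong)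

lemma trace_diag_diagonal_mult_diag: "trace (diag (diagonal A) ** diag \<nu>) = trace (A ** diag \<nu>)"
  by (simp add: trace_mult_diag) (simp add: diag_def diagonal_def)

lemma diag_mult_vector_nth: "(diag \<epsilon> *v \<nu>) $ i = \<epsilon> $ i * \<nu> $ i"
  by (simp add: matrix_vector_mult_def diag_def if_distrib[of "\<lambda>x. x * _"] cong: if_cong)

lemma diag_mult_diag: "diag \<epsilon> ** diag \<nu> = diag (diag \<epsilon> *v \<nu>)"
  unfolding diag_def[of "diag \<epsilon> *v \<nu>"] diag_mult_vector_nth
  by (simp add: vec_eq_iff diag_def matrix_matrix_mult_def if_distrib[of "\<lambda>x. x * _"] cong: if_cong)

lemma diag_convex_combination:
  "diag ((1 - t) *\<^sub>R u + t *\<^sub>R v) = (1 - t) *\<^sub>R diag u + t *\<^sub>R diag v"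
  by (simp add: vec_eq_iff diag_def)

lemma bilinear_trace_mult: "bilinear (\<lambda>A B :: real^'n^'n. trace (A ** B))"
  by (auto simp: bilinear_def linear_iff trace_def matrix_matrix_mult_def sum_distrib_left
      sum.distrib algebra_simps)

lemmas trace_mult_linear =
  bilinear_ladd[OF bilinear_trace_mult] bilinear_lmul[OF bilinear_trace_mult]
  bilinear_radd[OF bilinear_trace_mult] bilinear_rmul[OF bilinear_trace_mult]

lemma trace_mult_cyclic:
  fixes A B C D :: "real^'n^'n"
  shows "trace (A ** (B ** C ** D)) = trace (D ** A ** B ** C)"
  using trace_mul_sym[of "A ** B ** C" D] by (simp add: matrix_mul_assoc)

lemma rotation_matrix_mat_1: "rotation_matrix (mat 1 :: real^'n^'n)"
  by (simp add: rotation_matrix_def orthogonal_matrix_def)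

lemma rotation_matrix_mul:
  fixes A B :: "real^'n^'n"
  assumes "rotation_matrix A" "rotation_matrix B"
  shows "rotation_matrix (A ** B)"
  using assms by (simp add: rotation_matrix_def orthogonal_matrix_mul det_mul)

lemma rotation_matrix_transpose:
  fixes A :: "real^'n^'n"
  assumes "rotation_matrix A"
  shows "rotation_matrix (transpose A)"
  using assms by (auto simp: rotation_matrix_def orthogonal_matrix_def)

lemma rotation_matrix_diag_even_signs:
  assumes "\<epsilon> \<in> even_signs"
  shows "rotation_matrix (diag \<epsilon>)"
proof -
  have "\<epsilon> $ i * \<epsilon> $ i = 1" for i
    using assms by (auto simp: even_signs_def dest!: spec[of _ i])
  moreover have "det (diag \<epsilon>) = 1"
    using assms by (subst det_diagonal) (auto simp: even_signs_def diag_def)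
  ultimately show ?thesis
    by (auto simp: rotation_matrix_def orthogonal_matrix vec_eq_iff matrix_matrix_mult_def
        transpose_def diag_def mat_def if_distrib[of "\<lambda>x. _ * x"] cong: if_cong)
qed

lemma compact_rotation_matrices: "compact {Q :: real^'n^'n. rotation_matrix Q}"
proof -
  have "norm Q \<le> real CARD('n)" if "rotation_matrix Q" for Q :: "real^'n^'n"
  proof -
    have "norm Q \<le> (\<Sum>i\<in>UNIV. norm (Q $ i))"
      unfolding norm_vec_def by (rule L2_set_le_sum) simp
    also have "\<dots> = real CARD('n)"
      using that by (simp add: rotation_matrix_def orthogonal_matrix_orthonormal_rows row_def)
    finally show ?thesis .
  qed
  then have "bounded {Q :: real^'n^'n. rotation_matrix Q}"
    unfolding bounded_iff by blast
  moreover have "closed {Q :: real^'n^'n. rotation_matrix Q}"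
    unfolding rotation_matrix_def orthogonal_matrix det_def matrix_matrix_mult_def transpose_def
    by (intro closed_Collect_conj closed_Collect_eq continuous_intros)
  ultimately show ?thesis by (simp add: compact_eq_bounded_closed)
qed

lemma permutation_matrix_mult_vectorE:
  assumes "permutation_matrix S"
  obtains q where "q permutes UNIV" "\<And>v i. (S *v v) $ i = v $ q i"
proof -
  obtain p where "p permutes UNIV" and S_eq: "S = (\<chi> i j. if i = p j then 1 else 0)"
    using assms by (auto simp: permutation_matrix_def)
  have "i = p j \<longleftrightarrow> j = inv p i" for i j
    using permutes_inverses[OF \<open>p permutes UNIV\<close>] by metis
  then have "(S *v v) $ i = v $ inv p i" for v i
    by (simp add: S_eq matrix_vector_mult_def if_distrib[of "\<lambda>x. x * _"] cong: if_cong)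
  then show ?thesis using that permutes_inv[OF \<open>p permutes UNIV\<close>] by blast
qed

lemma sum_permutation_matrix:
  assumes "permutation_matrix S"
  shows "(\<Sum>i\<in>UNIV. f ((S *v v) $ i)) = (\<Sum>i\<in>UNIV. f (v $ i))"
  using assms by (elim permutation_matrix_mult_vectorE)
    (simp add: sum.permute[of _ UNIV "\<lambda>i. f (v $ i)"] o_def)

lemma prod_permutation_matrix:
  assumes "permutation_matrix S"
  shows "(\<Prod>i\<in>UNIV. f ((S *v v) $ i)) = (\<Prod>i\<in>UNIV. f (v $ i))"
  using assms by (elim permutation_matrix_mult_vectorE)
    (simp add: prod.permute[of _ UNIV "\<lambda>i. f (v $ i)"] o_def)

lemma signed_perm_invariantI:
  assumes "\<And>\<nu> S. permutation_matrix S \<Longrightarrow> \<Phi> (S *v \<nu>) = \<Phi> \<nu>"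
    and "\<And>\<nu> \<epsilon>. \<epsilon> \<in> even_signs \<Longrightarrow> \<Phi> (diag \<epsilon> *v \<nu>) = \<Phi> \<nu>"
  shows "signed_perm_invariant \<Phi>"
  using assms unfolding signed_perm_invariant_def signed_perms_def
  by (auto simp flip: matrix_vector_mul_assoc)

section \<open>Existence of signed singular values\<close>

definition givens :: "'n \<Rightarrow> 'n \<Rightarrow> real \<Rightarrow> real^'n^'n" where
  "givens i j t = (\<chi> a b.
     if a = i then (if b = i then cos t else 0) - (if b = j then sin t else 0)
     else if a = j then (if b = i then sin t else 0) + (if b = j then cos t else 0)
     else if b = a then 1 else 0)"

lemma transpose_givens:
  assumes "i \<noteq> j"
  shows "transpose (givens i j t) = givens i j (- t)"
  using assms by (auto simp: vec_eq_iff givens_def transpose_def)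

lemma givens_mult_left:
  assumes "i \<noteq> j"
  shows "(givens i j t ** M) $ a $ b =
    (if a = i then cos t * M $ i $ b - sin t * M $ j $ b
     else if a = j then sin t * M $ i $ b + cos t * M $ j $ b
     else M $ a $ b)"
  using assms
  by (simp add: givens_def matrix_matrix_mult_def algebra_simps sum_subtractf sum.distrib
      if_distrib[of "\<lambda>x. x * _"] if_distrib[of "\<lambda>x. _ * x"] cong: if_cong)

lemma givens_mult_right:
  assumes "i \<noteq> j"
  shows "(M ** givens i j t) $ a $ b =
    (if b = i then cos t * M $ a $ i + sin t * M $ a $ j
     else if b = j then cos t * M $ a $ j - sin t * M $ a $ i
     else M $ a $ b)"
proof -
  have "M ** givens i j t = transpose (givens i j (- t) ** transpose M)"
    using assms by (simp add: matrix_transpose_mul transpose_givens)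
  also have "\<dots> $ a $ b = (givens i j (- t) ** transpose M) $ b $ a"
    by (simp add: transpose_def)
  finally show ?thesis
    using assms by (simp add: givens_mult_left) (simp add: transpose_def)
qed

lemma givens_add:
  assumes "i \<noteq> j"
  shows "givens i j s ** givens i j t = givens i j (s + t)"
  using assms unfolding vec_eq_iff givens_mult_left[OF assms]
  by (auto simp: givens_def cos_add sin_add algebra_simps)

lemma rotation_matrix_givens:
  assumes "i \<noteq> j"
  shows "rotation_matrix (givens i j t)"
proof -
  have "givens i j 0 = mat 1"
    by (auto simp: vec_eq_iff givens_def mat_def)
  then have orthogonal: "orthogonal_matrix (givens i j t)"
    using givens_add[OF assms, of "-t" t] by (simp add: orthogonal_matrix transpose_givens[OF assms])
  have "det (givens i j t) = (det (givens i j (t / 2)))\<^sup>2"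
    using givens_add[OF assms, of "t/2" "t/2"] by (metis det_mul field_sum_of_halves power2_eq_square)
  then have "det (givens i j t) \<ge> 0" by simp
  then show ?thesis
    using orthogonal det_orthogonal_matrix[OF orthogonal] by (auto simp: rotation_matrix_def)
qed

lemma obtain_angle_square_eq:
  fixes x y :: real
  obtains t where "(x * cos t - y * sin t)\<^sup>2 = x\<^sup>2 + y\<^sup>2"
proof -
  obtain r a where polar: "x = r * cos a" "y = r * sin a"
    using polar_Ex by blast
  have "x * cos (- a) - y * sin (- a) = r * ((cos a)\<^sup>2 + (sin a)\<^sup>2)"
    unfolding polar cos_minus sin_minus by algebra
  moreover have "x\<^sup>2 + y\<^sup>2 = r\<^sup>2 * ((cos a)\<^sup>2 + (sin a)\<^sup>2)"
    unfolding polar by algebra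
  ultimately have "(x * cos (- a) - y * sin (- a))\<^sup>2 = x\<^sup>2 + y\<^sup>2"
    by simp
  then show thesis by (rule that)
qed

definition diagonal_energy :: "real^'n^'n \<Rightarrow> real" where
  "diagonal_energy M = (\<Sum>k\<in>UNIV. (M $ k $ k)\<^sup>2)"

lemma diagonal_energy_split:
  assumes "i \<noteq> j"
  shows "diagonal_energy M
    = (M $ i $ i)\<^sup>2 + (M $ j $ j)\<^sup>2 + (\<Sum>k\<in>UNIV - {i, j}. (M $ k $ k)\<^sup>2)"
  unfolding diagonal_energy_def using assms by (subst sum.subset_diff[of "{i, j}"]) auto

text \<open>In terms of the conformal part \<open>(a + d, c - b)\<close> and the anticonformal part
  \<open>(a - d, b + c)\<close> of the \<open>2 \<times> 2\<close> block, rotating from the left by \<open>s\<close> and from the right by \<open>t\<close>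
  rotates these by \<open>s + t\<close> and \<open>s - t\<close>, so they can be made real independently.\<close>

lemma obtain_givens_diagonal_energy:
  assumes "i \<noteq> j"
  obtains s t where "diagonal_energy (givens i j s ** M ** givens i j t)
    = diagonal_energy M + (M $ i $ j)\<^sup>2 + (M $ j $ i)\<^sup>2"
proof -
  define a b c d where "a = M $ i $ i" and "b = M $ i $ j" and "c = M $ j $ i" and "d = M $ j $ j"
  note block_defs = a_def b_def c_def d_def
  obtain \<alpha> where \<alpha>: "((a + d) * cos \<alpha> - (c - b) * sin \<alpha>)\<^sup>2 = (a + d)\<^sup>2 + (c - b)\<^sup>2"
    by (rule obtain_angle_square_eq)
  obtain \<beta> where \<beta>: "((a - d) * cos \<beta> - (b + c) * sin \<beta>)\<^sup>2 = (a - d)\<^sup>2 + (b + c)\<^sup>2"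
    by (rule obtain_angle_square_eq)
  define s t where "s = (\<alpha> + \<beta>) / 2" and "t = (\<alpha> - \<beta>) / 2"
  have angles: "\<alpha> = s + t" "\<beta> = s - t"
    by (simp_all add: s_def t_def field_simps)
  define N where "N = givens i j s ** M ** givens i j t"
  note N_nth = givens_mult_left[OF assms] givens_mult_right[OF assms]
  have "N $ i $ i + N $ j $ j = (a + d) * cos \<alpha> - (c - b) * sin \<alpha>"
    "N $ i $ i - N $ j $ j = (a - d) * cos \<beta> - (b + c) * sin \<beta>"
    using assms unfolding N_def angles block_defs
    by (simp_all add: N_nth cos_add sin_add cos_diff sin_diff algebra_simps)
  then have "(N $ i $ i + N $ j $ j)\<^sup>2 + (N $ i $ i - N $ j $ j)\<^sup>2
      = (a + d)\<^sup>2 + (c - b)\<^sup>2 + (a - d)\<^sup>2 + (b + c)\<^sup>2"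
    using \<alpha> \<beta> by simp
  then have "(N $ i $ i)\<^sup>2 + (N $ j $ j)\<^sup>2 = a\<^sup>2 + b\<^sup>2 + c\<^sup>2 + d\<^sup>2"
    by (simp add: power2_eq_square algebra_simps)
  moreover have "(\<Sum>k\<in>UNIV - {i, j}. (N $ k $ k)\<^sup>2) = (\<Sum>k\<in>UNIV - {i, j}. (M $ k $ k)\<^sup>2)"
    by (intro sum.cong) (auto simp: N_def N_nth)
  ultimately have "diagonal_energy N = diagonal_energy M + (M $ i $ j)\<^sup>2 + (M $ j $ i)\<^sup>2"
    by (simp add: diagonal_energy_split[OF assms] block_defs)
  then show thesis unfolding N_def by (rule that)
qed

lemma obtain_diagonal_energy_maximizer:
  fixes F :: "real^'n^'n"
  obtains A B where "rotation_matrix A" "rotation_matrix B"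
    "\<And>P Q. rotation_matrix P \<Longrightarrow> rotation_matrix Q \<Longrightarrow>
      diagonal_energy (P ** F ** Q) \<le> diagonal_energy (A ** F ** B)"
proof -
  define K where "K = {Q :: real^'n^'n. rotation_matrix Q}"
  have "compact (K \<times> K)" "K \<times> K \<noteq> {}"
    using compact_rotation_matrices rotation_matrix_mat_1 by (auto simp: K_def intro: compact_Times)
  moreover have "continuous_on (K \<times> K) (\<lambda>z. diagonal_energy (fst z ** F ** snd z))"
    unfolding diagonal_energy_def matrix_matrix_mult_def by (simp, intro continuous_intros)
  ultimately have "\<exists>z\<in>K \<times> K. \<forall>w\<in>K \<times> K.
      diagonal_energy (fst w ** F ** snd w) \<le> diagonal_energy (fst z ** F ** snd z)"
    by (rule continuous_attains_sup)
  then obtain z where z: "z \<in> K \<times> K" and maximal: "\<forall>w\<in>K \<times> K.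
      diagonal_energy (fst w ** F ** snd w) \<le> diagonal_energy (fst z ** F ** snd z)"
    by blast
  show thesis
  proof (rule that)
    show "diagonal_energy (P ** F ** Q) \<le> diagonal_energy (fst z ** F ** snd z)"
      if "rotation_matrix P" "rotation_matrix Q" for P Q
      using maximal[rule_format, of "(P, Q)"] that by (simp add: K_def)
  qed (use z in \<open>auto simp: K_def\<close>)
qed

text \<open>A variational Jacobi method: an off-diagonal entry of a maximiser of the diagonal energy
  could be moved to the diagonal by rotating in a coordinate plane.\<close>

lemma signed_singular_values_exist:
  fixes F :: "real^'n^'n"
  shows "\<exists>\<nu>. signed_singular_values F \<nu>"
proof -
  obtain A B where rotations: "rotation_matrix A" "rotation_matrix B"
    and maximal: "\<And>P Q. rotation_matrix P \<Longrightarrow> rotation_matrix Q \<Longrightarrow>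
      diagonal_energy (P ** F ** Q) \<le> diagonal_energy (A ** F ** B)"
    by (rule obtain_diagonal_energy_maximizer[of F]) (rule that)
  define M where "M = A ** F ** B"
  have "M $ i $ j = 0" if "i \<noteq> j" for i j
  proof -
    obtain s t where energy: "diagonal_energy (givens i j s ** M ** givens i j t)
        = diagonal_energy M + (M $ i $ j)\<^sup>2 + (M $ j $ i)\<^sup>2"
      using obtain_givens_diagonal_energy[OF \<open>i \<noteq> j\<close>] .
    have "diagonal_energy (givens i j s ** M ** givens i j t) \<le> diagonal_energy M"
      using maximal[of "givens i j s ** A" "B ** givens i j t"] rotations \<open>i \<noteq> j\<close>
      by (simp add: M_def rotation_matrix_mul rotation_matrix_givens matrix_mul_assoc)
    with energy show ?thesis
      by (simp add: sum_power2_le_zero_iff)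
  qed
  then have "M = diag (diagonal M)"
    by (auto simp: diag_def diagonal_def vec_eq_iff)
  moreover have "F = (transpose A ** A) ** F ** (B ** transpose B)"
    using rotations by (simp add: rotation_matrix_def orthogonal_matrix_def)
  then have "F = transpose A ** M ** transpose B"
    by (simp add: M_def matrix_mul_assoc)
  ultimately show ?thesis
    unfolding signed_singular_values_def
    using rotations rotation_matrix_transpose by metis
qed

lemma ssv_matrix_functionE:
  obtains R1 R2 \<nu> where "rotation_matrix R1" "rotation_matrix R2" "F = R1 ** diag \<nu> ** R2"
    "ssv_matrix_function \<Phi> F = \<Phi> \<nu>"
  using someI_ex[OF signed_singular_values_exist[of F]]
  unfolding ssv_matrix_function_def signed_singular_values_def by blast

section \<open>Pairing the minors with rotations\<close>

locale minors_pairing =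
  fixes minors :: "real^'n^'n \<Rightarrow> 'm::euclidean_space"
    and esym :: "real^'n \<Rightarrow> 'b::real_normed_vector"
    and pairing :: "real^'n^'n \<Rightarrow> 'm \<Rightarrow> 'b"
  assumes linear_pairing: "linear (pairing Q)"
    and affine_pairing: "pairing ((1 - t) *\<^sub>R P + t *\<^sub>R Q) z =
      (1 - t) *\<^sub>R pairing P z + t *\<^sub>R pairing Q z"
    and pairing_rotations: "rotation_matrix R1 \<Longrightarrow> rotation_matrix R2 \<Longrightarrow>
      pairing Q (minors (R1 ** F ** R2)) = pairing (R2 ** Q ** R1) (minors F)"
    and pairing_diagonal: "pairing (diag (diagonal Q)) (minors (diag \<nu>)) =
      pairing Q (minors (diag \<nu>))"
    and pairing_mat_1: "pairing (mat 1) (minors (diag \<nu>)) = esym \<nu>"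
    and diagonal_rotation_matrix: "rotation_matrix R \<Longrightarrow>
      diagonal R \<in> convex hull (even_signs :: (real^'n) set)"
    and esym_permutation: "permutation_matrix S \<Longrightarrow> esym (S *v \<nu>) = esym \<nu>"
begin

lemma pairing_even_signs:
  assumes "\<epsilon> \<in> even_signs"
  shows "pairing (diag \<epsilon>) (minors (diag \<nu>)) = esym (diag \<epsilon> *v \<nu>)"
proof -
  have "pairing (diag \<epsilon>) (minors (diag \<nu>)) = pairing (mat 1) (minors (diag \<epsilon> ** diag \<nu>))"
    using pairing_rotations[OF rotation_matrix_diag_even_signs[OF assms] rotation_matrix_mat_1]
    by simp
  then show ?thesis by (simp add: diag_mult_diag pairing_mat_1)
qed

context
  fixes \<psi> :: "'b \<Rightarrow> ereal"
  assumes convex: "convex_ext \<psi>"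
    and sign_invariant: "\<And>\<nu> \<epsilon>. \<epsilon> \<in> even_signs \<Longrightarrow> \<psi> (esym \<nu>) = \<psi> (esym (diag \<epsilon> *v \<nu>))"
begin

lemma pairing_rotation_matrix_le:
  assumes "rotation_matrix R"
  shows "\<psi> (pairing R (minors (diag \<nu>))) \<le> \<psi> (esym \<nu>)"
proof -
  have "convex_ext (\<lambda>v. \<psi> (pairing (diag v) (minors (diag \<nu>))))"
    by (rule convex_ext_compose_affine[OF convex]) (simp add: diag_convex_combination affine_pairing)
  moreover have "\<psi> (pairing (diag \<epsilon>) (minors (diag \<nu>))) \<le> \<psi> (esym \<nu>)" if "\<epsilon> \<in> even_signs" for \<epsilon>
    using that sign_invariant[of \<epsilon> \<nu>] by (simp add: pairing_even_signs)
  ultimately have "\<psi> (pairing (diag (diagonal R)) (minors (diag \<nu>))) \<le> \<psi> (esym \<nu>)"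
    using diagonal_rotation_matrix[OF assms] by (rule convex_ext_le_on_convex_hull)
  then show ?thesis by (simp add: pairing_diagonal)
qed

lemma ssv_matrix_function_eq_SUP_pairing:
  "ssv_matrix_function (\<lambda>\<nu>. \<psi> (esym \<nu>)) F =
    (SUP Q\<in>{Q. rotation_matrix Q}. \<psi> (pairing Q (minors F)))"
proof -
  obtain R1 R2 \<nu> where rotations: "rotation_matrix R1" "rotation_matrix R2"
    and F_eq: "F = R1 ** diag \<nu> ** R2"
    and value_eq: "ssv_matrix_function (\<lambda>\<nu>. \<psi> (esym \<nu>)) F = \<psi> (esym \<nu>)"
    using ssv_matrix_functionE[of F "\<lambda>\<nu>. \<psi> (esym \<nu>)"] .
  have pairing_F: "pairing Q (minors F) = pairing (R2 ** Q ** R1) (minors (diag \<nu>))" for Q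
    using rotations by (simp add: F_eq pairing_rotations)
  have "R2 ** (transpose R2 ** transpose R1) ** R1 = (R2 ** transpose R2) ** (transpose R1 ** R1)"
    by (simp add: matrix_mul_assoc)
  also have "\<dots> = mat 1"
    using rotations by (simp add: rotation_matrix_def orthogonal_matrix_def)
  finally have attained: "\<psi> (pairing (transpose R2 ** transpose R1) (minors F)) = \<psi> (esym \<nu>)"
    by (simp add: pairing_F pairing_mat_1)
  have "(SUP Q\<in>{Q. rotation_matrix Q}. \<psi> (pairing Q (minors F))) = \<psi> (esym \<nu>)"
  proof (rule cSup_eq_maximum)
    show "\<psi> (esym \<nu>) \<in> (\<lambda>Q. \<psi> (pairing Q (minors F))) ` {Q. rotation_matrix Q}"
      using rotations attained by (intro image_eqI[where x = "transpose R2 ** transpose R1"])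
        (simp_all add: rotation_matrix_mul rotation_matrix_transpose)
  qed (use rotations in \<open>auto simp: pairing_F rotation_matrix_mul intro!: pairing_rotation_matrix_le\<close>)
  with value_eq show ?thesis by simp
qed

theorem lsc_ssv_polyconvex_esym:
  assumes "range \<psi> \<subseteq> Rinf" "lower_semicontinuous \<psi>"
  shows "lsc_ssv_polyconvex minors (\<lambda>\<nu>. \<psi> (esym \<nu>))"
  unfolding lsc_ssv_polyconvex_def
proof (intro conjI)
  show "range (\<lambda>\<nu>. \<psi> (esym \<nu>)) \<subseteq> Rinf"
    using assms(1) by auto
  show "signed_perm_invariant (\<lambda>\<nu>. \<psi> (esym \<nu>))"
    by (rule signed_perm_invariantI) (simp_all add: esym_permutation flip: sign_invariant)
  show "lsc_polyconvex minors (ssv_matrix_function (\<lambda>\<nu>. \<psi> (esym \<nu>)))"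
    unfolding ssv_matrix_function_eq_SUP_pairing using assms convex linear_pairing rotation_matrix_mat_1
    by (intro lsc_polyconvex_SUP_linear) auto
qed

end

end

section \<open>Dimension 2\<close>

lemma prod_UNIV_2: "prod f (UNIV :: 2 set) = f 1 * f 2"
  by (simp add: UNIV_2)

lemma diagonal_rotation_matrix_2:
  fixes R :: "real^2^2"
  assumes "rotation_matrix R"
  shows "diagonal R \<in> convex hull even_signs"
proof -
  define c where "c = R $ 1 $ 1"
  have "orthogonal_matrix R" "det R = 1"
    using assms by (auto simp: rotation_matrix_def)
  then have "(R $ 1 $ 1)\<^sup>2 + (R $ 2 $ 1)\<^sup>2 = 1" "(R $ 1 $ 2)\<^sup>2 + (R $ 2 $ 2)\<^sup>2 = 1"
    "R $ 1 $ 1 * R $ 2 $ 2 - R $ 1 $ 2 * R $ 2 $ 1 = 1"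
    by (simp_all add: orthogonal_matrix vec_eq_iff forall_2 matrix_matrix_mult_def transpose_def
        mat_def sum_2 det_2 power2_eq_square)
  then have "(R $ 2 $ 2 - R $ 1 $ 1)\<^sup>2 + (R $ 1 $ 2 + R $ 2 $ 1)\<^sup>2 = 0"
    by (simp add: power2_eq_square algebra_simps)
  then have "R $ 2 $ 2 = c" by (simp add: c_def)
  have "c\<^sup>2 \<le> 1"
    using \<open>(R $ 1 $ 1)\<^sup>2 + (R $ 2 $ 1)\<^sup>2 = 1\<close> zero_le_power2[of "R $ 2 $ 1"]
    unfolding c_def by linarith
  then have "\<bar>c\<bar> \<le> 1" by (simp add: abs_square_le_1)
  have "vector [1, 1] \<in> (even_signs :: (real^2) set)" "vector [-1, -1] \<in> (even_signs :: (real^2) set)"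
    by (simp_all add: even_signs_def forall_2 prod_UNIV_2)
  then have "((1 + c) / 2) *\<^sub>R vector [1, 1] + ((1 - c) / 2) *\<^sub>R vector [-1, -1]
      \<in> convex hull (even_signs :: (real^2) set)"
    using \<open>\<bar>c\<bar> \<le> 1\<close> by (intro convexD convex_convex_hull hull_inc) (auto simp: field_simps)
  also have "((1 + c) / 2) *\<^sub>R vector [1, 1] + ((1 - c) / 2) *\<^sub>R vector [-1, -1] = diagonal R"
    using \<open>R $ 2 $ 2 = c\<close> by (simp add: vec_eq_iff forall_2 diagonal_def field_simps flip: c_def)
  finally show ?thesis .
qed

lemma esym2_permutation:
  assumes "permutation_matrix S"
  shows "esym2 (S *v v) = esym2 v"
proof -
  have "esym2 w = vector [(\<Sum>i\<in>UNIV. w $ i), (\<Prod>i\<in>UNIV. w $ i)]" for w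
    by (simp add: esym2_def sum_2 prod_UNIV_2)
  then show ?thesis
    by (simp add: sum_permutation_matrix[OF assms, of "\<lambda>x. x"]
        prod_permutation_matrix[OF assms, of "\<lambda>x. x"])
qed

definition pairing2 :: "real^2^2 \<Rightarrow> (real^2^2) \<times> real \<Rightarrow> real^2" where
  "pairing2 Q z = vector [trace (Q ** fst z), snd z]"

interpretation minors_pairing2: minors_pairing minors2 esym2 pairing2
proof (rule minors_pairing.intro)
  fix Q :: "real^2^2"
  show "linear (pairing2 Q)"
    by (rule linearI) (simp_all add: pairing2_def vec_eq_iff forall_2 trace_mult_linear)
next
  fix P Q :: "real^2^2" and t z
  show "pairing2 ((1 - t) *\<^sub>R P + t *\<^sub>R Q) z = (1 - t) *\<^sub>R pairing2 P z + t *\<^sub>R pairing2 Q z"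
    by (simp add: pairing2_def vec_eq_iff forall_2 trace_mult_linear) (simp add: algebra_simps)
next
  fix R1 R2 Q F :: "real^2^2"
  assume "rotation_matrix R1" "rotation_matrix R2"
  then show "pairing2 Q (minors2 (R1 ** F ** R2)) = pairing2 (R2 ** Q ** R1) (minors2 F)"
    by (simp add: pairing2_def minors2_def trace_mult_cyclic det_mul rotation_matrix_def)
next
  fix Q :: "real^2^2" and \<nu>
  show "pairing2 (diag (diagonal Q)) (minors2 (diag \<nu>)) = pairing2 Q (minors2 (diag \<nu>))"
    by (simp add: pairing2_def minors2_def trace_diag_diagonal_mult_diag)
next
  fix \<nu> :: "real^2"
  show "pairing2 (mat 1) (minors2 (diag \<nu>)) = esym2 \<nu>"
    by (simp add: pairing2_def minors2_def esym2_def trace_def sum_2 det_2 diag_def)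
qed (fact diagonal_rotation_matrix_2 esym2_permutation)+

section \<open>Dimension 3\<close>

lemma prod_UNIV_3: "prod f (UNIV :: 3 set) = f 1 * f 2 * f 3"
  unfolding UNIV_3 by (simp add: ac_simps)

lemma cofactor_matrix_mul_3:
  fixes A B :: "real^3^3"
  shows "cofactor_matrix (A ** B) = cofactor_matrix A ** cofactor_matrix B"
  by (simp add: vec_eq_iff forall_3 matrix_matrix_mult_def cofactor_matrix_def det_3 sum_3)
    (simp add: algebra_simps)

lemma cofactor_rotation_matrix_3:
  fixes R :: "real^3^3"
  assumes "rotation_matrix R"
  shows "cofactor_matrix R = R"
proof -
  have orthogonal: "transpose R ** R = mat 1" "det R = 1"
    using assms by (auto simp: rotation_matrix_def orthogonal_matrix_def)
  have "adjugate R = (transpose R ** R) ** adjugate R"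
    by (simp add: orthogonal)
  also have "\<dots> = transpose R"
    unfolding matrix_mul_assoc[symmetric] adjugate_mult_3 orthogonal(2) by simp
  finally show ?thesis by (metis adjugate_def transpose_transpose)
qed

text \<open>The axial vector of the antisymmetric part \<open>R - transpose R\<close> has the squared length
  \<open>(1 + trace R) * (3 - trace R)\<close>.\<close>

lemma trace_rotation_matrix_3_ge:
  fixes R :: "real^3^3"
  assumes "rotation_matrix R"
  shows "trace R \<ge> -1"
proof -
  let ?a = "R $ 1 $ 1" and ?b = "R $ 2 $ 2" and ?c = "R $ 3 $ 3"
  have "transpose R ** R = mat 1"
    using assms by (auto simp: rotation_matrix_def orthogonal_matrix_def)
  then have "?a\<^sup>2 + (R $ 2 $ 1)\<^sup>2 + (R $ 3 $ 1)\<^sup>2 = 1" "(R $ 1 $ 2)\<^sup>2 + ?b\<^sup>2 + (R $ 3 $ 2)\<^sup>2 = 1"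
    "(R $ 1 $ 3)\<^sup>2 + (R $ 2 $ 3)\<^sup>2 + ?c\<^sup>2 = 1"
    by (simp_all add: vec_eq_iff forall_3 matrix_matrix_mult_def transpose_def mat_def sum_3
        power2_eq_square)
  moreover have "cofactor_matrix R $ i $ i = R $ i $ i" for i
    using cofactor_rotation_matrix_3[OF assms] by simp
  from this[of 1] this[of 2] this[of 3]
  have "?b * ?c - R $ 2 $ 3 * R $ 3 $ 2 = ?a" "?a * ?c - R $ 1 $ 3 * R $ 3 $ 1 = ?b"
    "?a * ?b - R $ 1 $ 2 * R $ 2 $ 1 = ?c"
    by (simp_all add: cofactor_matrix_def det_3)
  ultimately have "(1 + trace R) * (3 - trace R)
      = (R $ 3 $ 2 - R $ 2 $ 3)\<^sup>2 + (R $ 1 $ 3 - R $ 3 $ 1)\<^sup>2 + (R $ 2 $ 1 - R $ 1 $ 2)\<^sup>2"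
    by (simp add: trace_def sum_3 power2_eq_square algebra_simps)
  then have "(1 + trace R) * (3 - trace R) \<ge> 0" by simp
  then show ?thesis by (auto simp: zero_le_mult_iff)
qed

lemma even_signs_3:
  "even_signs = {vector [1, 1, 1], vector [1, -1, -1], vector [-1, 1, -1],
    vector [-1, -1, 1] :: real^3}"
proof -
  have "\<epsilon> \<in> even_signs \<longleftrightarrow> (\<epsilon> $ 1, \<epsilon> $ 2, \<epsilon> $ 3) \<in> {(1, 1, 1), (1, -1, -1), (-1, 1, -1), (-1, -1, 1)}"
    for \<epsilon> :: "real^3"
    by (auto simp: even_signs_def forall_3 prod_UNIV_3)
  then show ?thesis by (simp add: set_eq_iff vec_eq_iff forall_3)
qed

text \<open>The even sign vectors are the vertices of a regular tetrahedron, and the coefficients below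
  are the barycentric coordinates.\<close>

lemma mem_convex_hull_even_signs_3:
  fixes v :: "real^3"
  assumes "\<And>\<epsilon>. \<epsilon> \<in> even_signs \<Longrightarrow> inner v \<epsilon> \<ge> -1"
  shows "v \<in> convex hull even_signs"
proof -
  note even_signs_sum = even_signs_3 vec_eq_iff forall_3 inner_vec_def sum_3
  have "(\<Sum>\<epsilon>\<in>even_signs. ((1 + inner v \<epsilon>) / 4) *\<^sub>R \<epsilon>) \<in> convex hull even_signs"
  proof (rule convex_sum)
    show "finite (even_signs :: (real^3) set)" by (simp add: even_signs_3)
    show "(\<Sum>\<epsilon>\<in>even_signs. (1 + inner v \<epsilon>) / 4) = 1"
      by (simp add: even_signs_sum field_simps)
    show "(1 + inner v \<epsilon>) / 4 \<ge> 0" if "\<epsilon> \<in> even_signs" for \<epsilon>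
      using assms[OF that] by simp
  qed (simp_all add: hull_inc)
  also have "(\<Sum>\<epsilon>\<in>even_signs. ((1 + inner v \<epsilon>) / 4) *\<^sub>R \<epsilon>) = v"
    by (simp add: even_signs_sum field_simps)
  finally show ?thesis .
qed

lemma diagonal_rotation_matrix_3:
  fixes R :: "real^3^3"
  assumes "rotation_matrix R"
  shows "diagonal R \<in> convex hull even_signs"
proof (rule mem_convex_hull_even_signs_3)
  fix \<epsilon> :: "real^3" assume "\<epsilon> \<in> even_signs"
  then have "trace (R ** diag \<epsilon>) \<ge> -1"
    using assms by (intro trace_rotation_matrix_3_ge rotation_matrix_mul rotation_matrix_diag_even_signs)
  then show "inner (diagonal R) \<epsilon> \<ge> -1"
    by (simp add: trace_mult_diag inner_vec_def diagonal_def)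
qed

lemma esym3_permutation:
  assumes "permutation_matrix S"
  shows "esym3 (S *v v) = esym3 v"
proof -
  have "esym3 w = vector [(\<Sum>i\<in>UNIV. w $ i),
      ((\<Sum>i\<in>UNIV. w $ i)\<^sup>2 - (\<Sum>i\<in>UNIV. (w $ i)\<^sup>2)) / 2, (\<Prod>i\<in>UNIV. w $ i)]" for w
    unfolding esym3_def vec_eq_iff forall_3
    by (simp add: sum_3 prod_UNIV_3) (simp add: power2_eq_square algebra_simps)
  then show ?thesis
    by (simp add: sum_permutation_matrix[OF assms, of "\<lambda>x. x"]
        sum_permutation_matrix[OF assms, of "\<lambda>x. x\<^sup>2"]
        prod_permutation_matrix[OF assms, of "\<lambda>x. x"])
qed

lemma cofactor_matrix_diag_3:
  fixes \<nu> :: "real^3"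
  shows "cofactor_matrix (diag \<nu>) = diag (vector [\<nu> $ 2 * \<nu> $ 3, \<nu> $ 1 * \<nu> $ 3, \<nu> $ 1 * \<nu> $ 2])"
  by (simp add: vec_eq_iff forall_3 cofactor_matrix_def det_3 diag_def)

definition pairing3 :: "real^3^3 \<Rightarrow> (real^3^3) \<times> (real^3^3) \<times> real \<Rightarrow> real^3" where
  "pairing3 Q z = vector [trace (Q ** fst z), trace (Q ** fst (snd z)), snd (snd z)]"

interpretation minors_pairing3: minors_pairing minors3 esym3 pairing3
proof (rule minors_pairing.intro)
  fix Q :: "real^3^3"
  show "linear (pairing3 Q)"
    by (rule linearI) (simp_all add: pairing3_def vec_eq_iff forall_3 trace_mult_linear)
next
  fix P Q :: "real^3^3" and t z
  show "pairing3 ((1 - t) *\<^sub>R P + t *\<^sub>R Q) z = (1 - t) *\<^sub>R pairing3 P z + t *\<^sub>R pairing3 Q z"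
    by (simp add: pairing3_def vec_eq_iff forall_3 trace_mult_linear) (simp add: algebra_simps)
next
  fix R1 R2 Q F :: "real^3^3"
  assume "rotation_matrix R1" "rotation_matrix R2"
  then show "pairing3 Q (minors3 (R1 ** F ** R2)) = pairing3 (R2 ** Q ** R1) (minors3 F)"
    by (simp add: pairing3_def minors3_def adjugate_def cofactor_matrix_mul_3
        cofactor_rotation_matrix_3 trace_mult_cyclic det_mul rotation_matrix_def)
next
  fix Q :: "real^3^3" and \<nu>
  show "pairing3 (diag (diagonal Q)) (minors3 (diag \<nu>)) = pairing3 Q (minors3 (diag \<nu>))"
    by (simp add: pairing3_def minors3_def adjugate_def cofactor_matrix_diag_3
        trace_diag_diagonal_mult_diag)
next
  fix \<nu> :: "real^3"
  show "pairing3 (mat 1) (minors3 (diag \<nu>)) = esym3 \<nu>"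
    by (simp add: pairing3_def minors3_def adjugate_def cofactor_matrix_diag_3)
      (simp add: esym3_def trace_def sum_3 det_3 diag_def)
qed (fact diagonal_rotation_matrix_3 esym3_permutation)+

theorem proposition5p2:
  shows "(\<forall>\<psi> :: real^2 \<Rightarrow> ereal.
            range \<psi> \<subseteq> Rinf \<and> convex_ext \<psi> \<and> lower_semicontinuous \<psi> \<and>
            (\<forall>\<nu>. \<forall>\<epsilon>\<in>even_signs. \<psi> (esym2 \<nu>) = \<psi> (esym2 (diag \<epsilon> *v \<nu>)))
            \<longrightarrow> lsc_ssv_polyconvex minors2 (\<lambda>\<nu>. \<psi> (esym2 \<nu>)))
       \<and> (\<forall>\<psi> :: real^3 \<Rightarrow> ereal.
            range \<psi> \<subseteq> Rinf \<and> convex_ext \<psi> \<and> lower_semicontinuous \<psi> \<and>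
            (\<forall>\<nu>. \<forall>\<epsilon>\<in>even_signs. \<psi> (esym3 \<nu>) = \<psi> (esym3 (diag \<epsilon> *v \<nu>)))
            \<longrightarrow> lsc_ssv_polyconvex minors3 (\<lambda>\<nu>. \<psi> (esym3 \<nu>)))"
proof (intro conjI allI impI; elim conjE)
  fix \<psi> :: "real^2 \<Rightarrow> ereal"
  assume "range \<psi> \<subseteq> Rinf" "convex_ext \<psi>" "lower_semicontinuous \<psi>"
    and "\<forall>\<nu>. \<forall>\<epsilon>\<in>even_signs. \<psi> (esym2 \<nu>) = \<psi> (esym2 (diag \<epsilon> *v \<nu>))"
  then show "lsc_ssv_polyconvex minors2 (\<lambda>\<nu>. \<psi> (esym2 \<nu>))"
    by (intro minors_pairing2.lsc_ssv_polyconvex_esym) blast+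
next
  fix \<psi> :: "real^3 \<Rightarrow> ereal"
  assume "range \<psi> \<subseteq> Rinf" "convex_ext \<psi>" "lower_semicontinuous \<psi>"
    and "\<forall>\<nu>. \<forall>\<epsilon>\<in>even_signs. \<psi> (esym3 \<nu>) = \<psi> (esym3 (diag \<epsilon> *v \<nu>))"
  then show "lsc_ssv_polyconvex minors3 (\<lambda>\<nu>. \<psi> (esym3 \<nu>))"
    by (intro minors_pairing3.lsc_ssv_polyconvex_esym) blast+
qed

end
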